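(* If $n\ge 3$ and $m\ge 12$, then $\widehat{\chi}_{\rho}(P_m, P_n)\in\{6,7\}$.
   Context: For graphs $G$ and $H$ and a function $f\colon V(G)\to V(H)$, the Sierpiński product $G\otimes_f H$ is the graph with vertex set $V(G)\times V(H)$ whose edges are: $(g,h)(g,h')$ for every $g\in V(G)$ and every edge $hh'\in E(H)$; and $(g,f(g'))(g',f(g))$ for every edge $gg'\in E(G)$. Let $H^G$ denote the set of all functions $V(G)\to V(H)$. For a graph $X$, a packing $k$-coloring is a map $c\colon V(X)\to\{1,\dots,k\}$ such that whenever $u\neq v$ and $c(u)=c(v)=\ell$, the shortest-path distance satisfies $d_X(u,v)>\ell$; the packing chromatic number $\chi_\rho(X)$ is the least $k$ for which a packing $k$-coloring exists. The upper Sierpiński packing chromatic number of $(G,H)$ is $\widehat{\chi}_\rho(G,H)=\max_{f\in H^G}\chi_\rho(G\otimes_f H)$. $P_m$ denotes the path on $m$ vertices. *)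

theory Defs
  imports "Graph_Theory.Graph_Theory" "HOL-Library.FuncSet"
begin

text \<open>
  A simple graph is a \<open>pair_graph\<close>: a finite, loopless, symmetric digraph, so that every
  edge \<open>uv\<close> is represented by both arcs \<open>(u, v)\<close> and \<open>(v, u)\<close>.
\<close>

definition path_graph :: "nat \<Rightarrow> nat pair_pre_digraph" where
  "path_graph m =
    \<lparr> pverts = {1..m},
      parcs = {(i, j). i \<in> {1..m} \<and> j \<in> {1..m} \<and> (j = Suc i \<or> i = Suc j)} \<rparr>"

text \<open>
  Since \<open>(g, g')\<close> ranges over both orientations of an edge, the second set of arcs is symmetric.
\<close>

definition sierpinski_product ::
  "'a pair_pre_digraph \<Rightarrow> ('a \<Rightarrow> 'b) \<Rightarrow> 'b pair_pre_digraph \<Rightarrow> ('a \<times> 'b) pair_pre_digraph" where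
  "sierpinski_product G f H =
    \<lparr> pverts = pverts G \<times> pverts H,
      parcs = {((g, h), (g, h')) | g h h'. g \<in> pverts G \<and> (h, h') \<in> parcs H}
            \<union> {((g, f g'), (g', f g)) | g g'. (g, g') \<in> parcs G} \<rparr>"

text \<open>
  The shortest-path distance is the library's \<open>\<mu>\<close> with all arc weights equal to 1;
  it is infinite between vertices of different components.
\<close>

definition graph_dist :: "'a pair_pre_digraph \<Rightarrow> 'a \<Rightarrow> 'a \<Rightarrow> ereal" where
  "graph_dist X u v = wf_digraph.\<mu> (with_proj X) (\<lambda>_. 1) u v"

definition packing_coloring :: "'a pair_pre_digraph \<Rightarrow> nat \<Rightarrow> ('a \<Rightarrow> nat) \<Rightarrow> bool" where
  "packing_coloring X k c \<longleftrightarrow>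
    c \<in> pverts X \<rightarrow> {1..k} \<and>
    (\<forall>u\<in>pverts X. \<forall>v\<in>pverts X. u \<noteq> v \<and> c u = c v \<longrightarrow> graph_dist X u v > ereal (real (c u)))"

definition packing_chromatic_number :: "'a pair_pre_digraph \<Rightarrow> nat" where
  "packing_chromatic_number X = (LEAST k. \<exists>c. packing_coloring X k c)"

definition upper_sierpinski_packing_chromatic_number ::
  "'a pair_pre_digraph \<Rightarrow> 'b pair_pre_digraph \<Rightarrow> nat" where
  "upper_sierpinski_packing_chromatic_number G H =
    Max ((\<lambda>f. packing_chromatic_number (sierpinski_product G f H)) ` (pverts G \<rightarrow>\<^sub>E pverts H))"

text \<open>
  The notions above are well defined: the graphs are simple graphs, and neither the \<open>LEAST\<close>
  nor the \<open>Max\<close> is degenerate.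
\<close>

lemma pair_graph_path_graph: "pair_graph (path_graph m)"
proof
  have "parcs (path_graph m) \<subseteq> {1..m} \<times> {1..m}"
    by (auto simp: path_graph_def)
  then show "finite (parcs (path_graph m))"
    by (rule finite_subset) simp
  show "symmetric (with_proj (path_graph m))"
    by (auto simp: symmetric_def sym_def path_graph_def)
qed (auto simp: path_graph_def)

lemma pair_graph_sierpinski_product:
  assumes "pair_graph G" "pair_graph H" "f \<in> pverts G \<rightarrow> pverts H"
  shows "pair_graph (sierpinski_product G f H)"
proof -
  interpret G: pair_graph G by fact
  interpret H: pair_graph H by fact
  let ?S = "sierpinski_product G f H"
  have G: "x \<in> pverts G" "y \<in> pverts G" "(y, x) \<in> parcs G" "x \<noteq> y"
    if "(x, y) \<in> parcs G" for x y
    using that G.wellformed' G.pair_no_loops[of "(x, y)"] G.pair_sym_arcs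
    by (auto simp: symmetric_def sym_def)
  have H: "x \<in> pverts H" "y \<in> pverts H" "(y, x) \<in> parcs H" "x \<noteq> y"
    if "(x, y) \<in> parcs H" for x y
    using that H.wellformed' H.pair_no_loops[of "(x, y)"] H.pair_sym_arcs
    by (auto simp: symmetric_def sym_def)
  have sub: "parcs ?S \<subseteq> pverts ?S \<times> pverts ?S"
    using assms(3) by (auto simp: sierpinski_product_def dest: G H)
  have fin: "finite (pverts ?S)"
    using G.pair_finite_verts H.pair_finite_verts by (simp add: sierpinski_product_def)
  show ?thesis
  proof
    show "finite (parcs ?S)"
      using sub fin by (meson finite_SigmaI finite_subset)
    show "symmetric (with_proj ?S)"
      by (auto simp: symmetric_def sym_def sierpinski_product_def dest: G(3) H(3))
    show "fst e \<noteq> snd e" if "e \<in> parcs ?S" for e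
      using that G(4) H(4) by (fastforce simp: sierpinski_product_def)
  qed (use sub fin in auto)
qed

lemma packing_coloring_exists:
  assumes "finite (pverts X)"
  shows "\<exists>c. packing_coloring X (card (pverts X)) c"
proof -
  obtain c where c: "bij_betw c (pverts X) {1..card (pverts X)}"
    using finite_same_card_bij[OF assms, of "{1..card (pverts X)}"] by auto
  then have "packing_coloring X (card (pverts X)) c"
    unfolding packing_coloring_def bij_betw_def by (auto dest: inj_onD)
  then show ?thesis by blast
qed

lemma packing_chromatic_number_attained:
  assumes "finite (pverts X)"
  shows "\<exists>c. packing_coloring X (packing_chromatic_number X) c"
  unfolding packing_chromatic_number_def
  using packing_coloring_exists[OF assms] by (rule LeastI)

lemma upper_sierpinski_packing_chromatic_number_attained:
  assumes "finite (pverts G)" "finite (pverts H)" "pverts H \<noteq> {}"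
  shows "\<exists>f \<in> pverts G \<rightarrow>\<^sub>E pverts H.
    packing_chromatic_number (sierpinski_product G f H) =
      upper_sierpinski_packing_chromatic_number G H"
proof -
  let ?A = "(\<lambda>f. packing_chromatic_number (sierpinski_product G f H)) ` (pverts G \<rightarrow>\<^sub>E pverts H)"
  have "finite ?A" "?A \<noteq> {}"
    using assms by (auto simp: finite_PiE PiE_eq_empty_iff)
  then have "Max ?A \<in> ?A"
    by (rule Max_in)
  then show ?thesis
    unfolding upper_sierpinski_packing_chromatic_number_def by (metis (no_types, lifting) imageE)
qed

end

theory Submission
  imports Defs
begin

text \<open>
  Every product \<open>P\<^sub>m \<otimes>\<^sub>f P\<^sub>n\<close> is a tree: a path (the spine) running through all copies of \<open>P\<^sub>n\<close>, with
  at most two paths hanging off each of its vertices. It therefore embeds into an infinite comb, for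
  which 7 colors suffice: color the spine periodically by 2, 4, 3, 5, 2, 6, 3, 7 and each hanging path
  by 1, 2, 1, 3, 1, 2, 1, 3, \<dots>, exchanging 2 and 3 where the spine vertex has color 2. This works
  because 2 and 3 are never adjacent on the spine.

  Conversely, for \<open>f\<close> constantly 2 the product contains a caterpillar whose spine has 12 vertices, each
  with two leaves. Only the leaves of spine vertices of color 1 restrict a 5-coloring, and their
  colors are forced by the spine, so a search over the spine colors alone (777 partial colorings)
  rules out 5 colors.
\<close>

section \<open>Distances as walk lengths\<close>

lemma awalk_imp_relpow:
  assumes "wf_digraph (with_proj X)" and "pre_digraph.awalk (with_proj X) u p v"
  shows "(u, v) \<in> parcs X ^^ length p"
  using assms(2)
proof (induction p arbitrary: u)
  case Nil
  then show ?case by (simp add: wf_digraph.awalk_Nil_iff[OF assms(1)])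
next
  case (Cons e p)
  obtain w where "e = (u, w)" "e \<in> parcs X" "pre_digraph.awalk (with_proj X) w p v"
    using Cons.prems by (cases e) (simp add: wf_digraph.awalk_Cons_iff[OF assms(1)])
  then show ?case
    using Cons.IH relpow_Suc_I2[of u w "parcs X" v "length p"] by simp
qed

lemma relpow_imp_awalk:
  assumes "wf_digraph (with_proj X)" and "(u, v) \<in> parcs X ^^ k" and "u \<in> pverts X"
  shows "\<exists>p. pre_digraph.awalk (with_proj X) u p v \<and> length p = k"
  using assms(2,3)
proof (induction k arbitrary: u)
  case 0
  then show ?case by (simp add: wf_digraph.awalk_Nil_iff[OF assms(1)])
next
  case (Suc k)
  obtain w where w: "(u, w) \<in> parcs X" "(w, v) \<in> parcs X ^^ k"
    using relpow_Suc_D2[OF Suc.prems(1)] by blast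
  have "w \<in> pverts X"
    using wf_digraph.head_in_verts[OF assms(1), of "(u, w)"] w(1) by simp
  then obtain p where p: "pre_digraph.awalk (with_proj X) w p v" "length p = k"
    using Suc.IH[OF w(2)] by blast
  have "pre_digraph.awalk (with_proj X) u ((u, w) # p) v"
    using w(1) p(1) by (simp add: wf_digraph.awalk_Cons_iff[OF assms(1)])
  with p(2) show ?case by (intro exI[of _ "(u, w) # p"]) simp
qed

lemma graph_dist_greater_iff:
  assumes "wf_digraph (with_proj X)" and "u \<in> pverts X"
  shows "graph_dist X u v > ereal (real l) \<longleftrightarrow> (\<forall>k. (u, v) \<in> parcs X ^^ k \<longrightarrow> l < k)"
proof -
  interpret wf_digraph "with_proj X" by fact
  have cost: "awalk_cost (\<lambda>_. 1) p = real (length p)" for p :: "('a \<times> 'a) list"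
    by (simp add: awalk_cost_def sum_list_triv)
  show ?thesis
  proof
    assume far: "graph_dist X u v > ereal (real l)"
    show "\<forall>k. (u, v) \<in> parcs X ^^ k \<longrightarrow> l < k"
    proof (intro allI impI)
      fix k assume "(u, v) \<in> parcs X ^^ k"
      then obtain p where p: "awalk u p v" "length p = k"
        using relpow_imp_awalk[OF assms(1) _ assms(2)] by blast
      have "ereal (real l) < ereal (real k)"
        using less_le_trans[OF far[unfolded graph_dist_def] min_cost_le_walk_cost[OF p(1)]] p(2) cost
        by simp
      then show "l < k" by simp
    qed
  next
    assume far: "\<forall>k. (u, v) \<in> parcs X ^^ k \<longrightarrow> l < k"
    \<comment> \<open>An infimum of values above \<open>l\<close> need not exceed \<open>l\<close>;
      as walk lengths are integers, \<open>Suc l\<close> is a lower bound.\<close>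
    have "ereal (real (Suc l)) \<le> \<mu> (\<lambda>_. 1) u v"
      unfolding \<mu>_def
    proof (rule INF_greatest)
      fix p assume "p \<in> {p. awalk u p v}"
      then have "l < length p"
        using far awalk_imp_relpow[OF assms(1)] by blast
      then show "ereal (real (Suc l)) \<le> ereal (awalk_cost (\<lambda>_. 1) p)"
        unfolding cost by simp
    qed
    then show "graph_dist X u v > ereal (real l)"
      unfolding graph_dist_def by (rule less_le_trans[rotated]) simp
  qed
qed

lemma packing_coloring_iff:
  assumes "wf_digraph (with_proj X)"
  shows "packing_coloring X k c \<longleftrightarrow> c \<in> pverts X \<rightarrow> {1..k} \<and>
    (\<forall>u\<in>pverts X. \<forall>v\<in>pverts X. \<forall>d. u \<noteq> v \<and> c u = c v \<and> (u, v) \<in> parcs X ^^ d \<longrightarrow> c u < d)"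
  unfolding packing_coloring_def using graph_dist_greater_iff[OF assms] by blast

lemma wf_sierpinski_product_path_graph:
  assumes "f \<in> {1..m} \<rightarrow> {1..n}"
  shows "wf_digraph (with_proj (sierpinski_product (path_graph m) f (path_graph n)))"
proof -
  interpret pair_graph "sierpinski_product (path_graph m) f (path_graph n)"
    using assms by (intro pair_graph_sierpinski_product pair_graph_path_graph) (simp add: path_graph_def)
  show ?thesis by unfold_locales
qed


section \<open>A packing 7-coloring of the double comb\<close>

text \<open>
  The double comb lives on \<open>\<int> \<times> \<int>\<close>: the vertical lines are infinite paths, and consecutive
  lines are joined only at height 0, the spine.
\<close>

definition comb_dist :: "int \<times> int \<Rightarrow> int \<times> int \<Rightarrow> int" where
  "comb_dist p q = (if fst p = fst q then \<bar>snd p - snd q\<bar>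
     else \<bar>fst p - fst q\<bar> + \<bar>snd p\<bar> + \<bar>snd q\<bar>)"

definition comb_adj :: "int \<times> int \<Rightarrow> int \<times> int \<Rightarrow> bool" where
  "comb_adj p q \<longleftrightarrow> fst p = fst q \<and> \<bar>snd p - snd q\<bar> = 1 \<or>
     snd p = 0 \<and> snd q = 0 \<and> \<bar>fst p - fst q\<bar> = 1"

definition spine_color :: "int \<Rightarrow> nat" where
  "spine_color i = [2, 4, 3, 5, 2, 6, 3, 7] ! nat (i mod 8)"

definition comb_color :: "int \<times> int \<Rightarrow> nat" where
  "comb_color p = (if snd p = 0 then spine_color (fst p)
     else if odd (snd p) then 1
     else if (snd p mod 4 = 2) = (spine_color (fst p) = 2) then 3 else 2)"

text \<open>By induction along a walk in the comb, \<open>comb_dist\<close> bounds its length from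
  below.\<close>

lemma comb_dist_adj:
  assumes "comb_adj q r"
  shows "comb_dist p r \<le> comb_dist p q + 1"
  using assms unfolding comb_adj_def comb_dist_def by (auto split: if_splits)

lemma spine_color_cases:
  obtains "i mod 8 = 0" "spine_color i = 2" | "i mod 8 = 1" "spine_color i = 4"
  | "i mod 8 = 2" "spine_color i = 3" | "i mod 8 = 3" "spine_color i = 5"
  | "i mod 8 = 4" "spine_color i = 2" | "i mod 8 = 5" "spine_color i = 6"
  | "i mod 8 = 6" "spine_color i = 3" | "i mod 8 = 7" "spine_color i = 7"
proof -
  have "i mod 8 = 0 \<or> i mod 8 = 1 \<or> i mod 8 = 2 \<or> i mod 8 = 3 \<or>
      i mod 8 = 4 \<or> i mod 8 = 5 \<or> i mod 8 = 6 \<or> i mod 8 = 7"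
    by presburger
  then show thesis
    by (elim disjE) (rule that; simp add: spine_color_def)+
qed

lemma comb_color_range: "comb_color p \<in> {1..7}"
  by (rule spine_color_cases[of "fst p"]) (simp_all add: comb_color_def)

lemma mod_eq_imp_abs_diff_ge:
  fixes a b k :: int
  assumes "a mod k = b mod k" and "a \<noteq> b"
  shows "k \<le> \<bar>a - b\<bar>"
proof -
  have "k dvd \<bar>a - b\<bar>"
    using assms(1) by (simp add: mod_eq_dvd_iff)
  then show ?thesis
    using assms(2) by (intro zdvd_imp_le) auto
qed

lemma spine_color_mod_4:
  assumes "spine_color i < 4"
  shows "i mod 4 = (if spine_color i = 2 then 0 else 2)"
proof -
  have "i mod 4 = i mod 8 mod 4" by (simp add: mod_mod_cancel)
  also have "\<dots> = (if spine_color i = 2 then 0 else 2)"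
    using assms by (cases i rule: spine_color_cases) simp_all
  finally show ?thesis .
qed

text \<open>Colors 2 and 3 recur with period 4; each of 4, 5, 6, 7 occurs once in a period of
  8.\<close>

lemma spine_color_packing:
  assumes "i \<noteq> k" and "spine_color i = spine_color k"
  shows "int (spine_color i) < \<bar>i - k\<bar>"
proof (cases "spine_color i < 4")
  case True
  then have "i mod 4 = k mod 4"
    using assms(2) by (simp add: spine_color_mod_4)
  with mod_eq_imp_abs_diff_ge[OF _ assms(1)] True show ?thesis by force
next
  case False
  then have "i mod 8 = k mod 8 \<and> spine_color i < 8"
    using assms(2) by (cases i rule: spine_color_cases; cases k rule: spine_color_cases) simp_all
  with mod_eq_imp_abs_diff_ge[OF _ assms(1)] show ?thesis by force
qed

lemma spine_color_2_3_apart: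
  assumes "spine_color i = 2" and "spine_color k = 3"
  shows "2 \<le> \<bar>i - k\<bar>"
proof -
  have "i mod 4 = 0" "k mod 4 = 2"
    using assms spine_color_mod_4[of i] spine_color_mod_4[of k] by simp_all
  then show ?thesis by presburger
qed

lemma comb_color_packing:
  assumes "p \<noteq> q" and "comb_color p = comb_color q"
  shows "int (comb_color p) < comb_dist p q"
proof -
  obtain i j k l where p: "p = (i, j)" and q: "q = (k, l)" by fastforce
  have low: "spine_color i \<ge> 2" for i
    by (cases i rule: spine_color_cases) simp_all
  have far: "2 \<le> \<bar>h\<bar>" "h mod 4 = 2 \<or> h mod 4 = 0 \<and> 4 \<le> \<bar>h\<bar>" if "even h" "h \<noteq> 0" for h :: int
    using that by presburger+
  \<comment> \<open>The shared color is 2 or 3. If \<open>j\<close> is 2 mod 4, color 2 gives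
    distance at least 1 + 2; for color 3, line \<open>i\<close> has spine color 2, so the lines are
    2 apart and the distance is at least 4. Otherwise the height alone is at least 4.\<close>
  have off_spine: "comb_color (i, j) < comb_dist (i, j) (k, 0)"
    if "j \<noteq> 0" "comb_color (i, j) = comb_color (k, 0)" "i \<noteq> k" for i j k
  proof -
    have "even j" and c: "spine_color k = comb_color (i, j)"
      using that low[of k] by (auto simp: comb_color_def split: if_splits)
    with far[of j] spine_color_2_3_apart[of i k] that(1,3) show ?thesis
      by (auto simp: comb_color_def comb_dist_def split: if_splits)
  qed
  consider "j = 0" "l = 0" | "odd j \<or> odd l" | "even j" "even l" "i = k" "j \<noteq> 0 \<or> l \<noteq> 0"
    | "even j" "even l" "i \<noteq> k" "j \<noteq> 0" "l \<noteq> 0" | "j = 0" "l \<noteq> 0" "i \<noteq> k" | "j \<noteq> 0" "l = 0" "i \<noteq> k"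
    by blast
  then show ?thesis
  proof cases
    case 1
    then show ?thesis
      using assms p q spine_color_packing[of i k] by (auto simp: comb_color_def comb_dist_def)
  next
    case 2
    then have "comb_color p = 1" and odd: "odd j" "odd l"
      using assms(2) p q low[of i] low[of k] by (auto simp: comb_color_def split: if_splits)
    moreover have "j \<noteq> l \<Longrightarrow> 2 \<le> \<bar>j - l\<bar>" "1 \<le> \<bar>j\<bar>" "1 \<le> \<bar>l\<bar>"
      using odd by presburger+
    ultimately show ?thesis
      using assms(1) p q by (auto simp: comb_dist_def)
  next
    case 3
    \<comment> \<open>If one vertex is on the spine, its color is 2 or 3, which is the color its
      line repeats at heights divisible by 4; so the period 4 extends through height 0.\<close>
    have "j mod 4 = l mod 4 \<and> comb_color p < 4"
      using far[of j] far[of l] 3 assms(2) p q by (auto simp: comb_color_def split: if_splits)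
    then show ?thesis
      using mod_eq_imp_abs_diff_ge[of j 4 l] assms(1) 3 p q by (auto simp: comb_dist_def)
  next
    case 4
    then show ?thesis
      using far(1)[of j] far(1)[of l] p q by (auto simp: comb_color_def comb_dist_def)
  next
    case 5
    then show ?thesis
      using off_spine[of l k i] assms(2) p q by (auto simp: comb_dist_def abs_minus_commute)
  next
    case 6
    then show ?thesis
      using off_spine[of j i k] assms(2) p q by simp
  qed
qed

section \<open>Embedding the product into the comb\<close>

text \<open>
  In the copy of \<open>P\<^sub>n\<close> at \<open>g\<close>, the edges to the neighboring copies are attached at
  \<open>a = f (g - 1)\<close> and \<open>b = f (g + 1)\<close>; \<open>clamp a b h\<close> is the spine vertex nearest to \<open>h\<close>.
\<close>

definition clamp :: "int \<Rightarrow> int \<Rightarrow> int \<Rightarrow> int" where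
  "clamp a b h = max (min a b) (min (max a b) h)"

lemma clamp_ends [simp]: "clamp a b a = a" "clamp a b b = b"
  by (auto simp: clamp_def)

lemma abs_clamp_le: "\<bar>clamp a b h - a\<bar> \<le> \<bar>b - a\<bar>"
  by (cases "a \<le> b") (auto simp: clamp_def)

text \<open>All values lie on one side of \<open>a\<close>, so the distance from \<open>a\<close>
  determines them.\<close>

lemma clamp_eqI:
  assumes "\<bar>clamp a b h - a\<bar> = \<bar>clamp a b h' - a\<bar>"
  shows "clamp a b h = clamp a b h'"
proof (cases "a \<le> b")
  case True
  then have "a \<le> clamp a b h" "a \<le> clamp a b h'" by (auto simp: clamp_def)
  with assms show ?thesis by simp
next
  case False
  then have "clamp a b h \<le> a" "clamp a b h' \<le> a" by (auto simp: clamp_def)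
  with assms show ?thesis by simp
qed

text \<open>A step in a copy stays over one spine vertex, along a hanging path, or runs along the
  spine.\<close>

lemma clamp_step:
  "clamp a b (h + 1) = clamp a b h \<or>
   clamp a b h = h \<and> clamp a b (h + 1) = h + 1 \<and> \<bar>\<bar>h - a\<bar> - \<bar>h + 1 - a\<bar>\<bar> = 1"
  by (cases "a \<le> b") (auto simp: clamp_def max_def min_def)

lemma packing_coloring_sierpinski_product_path_graph:
  assumes f: "f \<in> {1..m} \<rightarrow> {1..n}"
  shows "\<exists>c. packing_coloring (sierpinski_product (path_graph m) f (path_graph n)) 7 c"
proof -
  let ?X = "sierpinski_product (path_graph m) f (path_graph n)"
  define F where "F g = int (f g)" for g
  \<comment> \<open>\<open>S g\<close> is the spine position at which the copy of \<open>g\<close> is entered. For the two end copies the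
    missing attachment vertex is the arbitrary value \<open>f 0\<close> or \<open>f (m + 1)\<close>, which is harmless.\<close>
  define S where "S = rec_nat 0 (\<lambda>g s. s + \<bar>F (Suc g) - F (g - 1)\<bar> + 1)"
  have S_Suc: "S (Suc g) = S g + \<bar>F (Suc g) - F (g - 1)\<bar> + 1" for g
    by (simp add: S_def)
  define foot where "foot v = clamp (F (fst v - 1)) (F (Suc (fst v))) (int (snd v))" for v
  \<comment> \<open>Position along the spine and signed height over it; the sign separates the two
    hanging paths at a vertex.\<close>
  define \<phi> where "\<phi> v = (S (fst v) + \<bar>foot v - F (fst v - 1)\<bar>, int (snd v) - foot v)" for v
  have S_mono: "S g < S g'" if "g < g'" for g g'
    using that by (rule less_Suc_induct) (auto simp: S_Suc)
  \<comment> \<open>The spine intervals of different copies are disjoint, so the position determines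
    the copy.\<close>
  have block: "S (fst v) \<le> fst (\<phi> v)" "fst (\<phi> v) < S (Suc (fst v))" for v
    using abs_clamp_le[of "F (fst v - 1)" "F (Suc (fst v))" "int (snd v)"]
    by (auto simp: \<phi>_def S_Suc foot_def)
  have inj: "u = v" if "\<phi> u = \<phi> v" for u v
  proof -
    have "\<not> fst u < fst v" if "\<phi> u = \<phi> v" for u v
    proof
      assume "fst u < fst v"
      then have "S (Suc (fst u)) \<le> S (fst v)"
        using S_mono[of "Suc (fst u)" "fst v"] by (cases "Suc (fst u) = fst v") auto
      with block(2)[of u] block(1)[of v] that show False by simp
    qed
    from this[OF that] this[OF that[symmetric]] have g: "fst u = fst v" by simp
    have "foot u = foot v"
      using that g unfolding \<phi>_def foot_def g by (intro clamp_eqI) simp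
    with that have "snd u = snd v"
      by (simp add: \<phi>_def)
    with g show ?thesis by (rule prod_eqI)
  qed
  have hom: "comb_adj (\<phi> u) (\<phi> v)" if "(u, v) \<in> parcs ?X" for u v
  proof -
    \<comment> \<open>Copy \<open>g\<close> is left at position \<open>S (Suc g) - 1\<close> and the
      next one entered at \<open>S (Suc g)\<close>: the summand 1 in \<open>S\<close> is this
      edge.\<close>
    have conn: "comb_adj (\<phi> (g, f (Suc g))) (\<phi> (Suc g, f g))" for g
      by (simp add: comb_adj_def \<phi>_def foot_def S_Suc flip: F_def)
    have sym: "comb_adj p q \<Longrightarrow> comb_adj q p" for p q
      by (auto simp: comb_adj_def)
    have vert: "comb_adj (\<phi> (g, h)) (\<phi> (g, Suc h))" for g h
      using clamp_step[of "F (g - 1)" "F (Suc g)" "int h"]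
      by (auto simp: comb_adj_def \<phi>_def foot_def add.commute)
    show ?thesis
      using that vert conn by (auto simp: sierpinski_product_def path_graph_def intro: sym)
  qed
  have lip: "comb_dist (\<phi> u) (\<phi> v) \<le> int d" if "(u, v) \<in> parcs ?X ^^ d" for u v d
    using that
  proof (induction d arbitrary: v)
    case 0
    then show ?case by (simp add: comb_dist_def)
  next
    case (Suc d)
    then obtain w where "(u, w) \<in> parcs ?X ^^ d" "(w, v) \<in> parcs ?X" by auto
    then show ?case using Suc.IH[of w] comb_dist_adj[OF hom, of w v "\<phi> u"] by simp
  qed
  have "packing_coloring ?X 7 (comb_color \<circ> \<phi>)"
    unfolding packing_coloring_iff[OF wf_sierpinski_product_path_graph[OF f]]
  proof (intro conjI ballI allI impI)
    show "comb_color \<circ> \<phi> \<in> pverts ?X \<rightarrow> {1..7}"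
      using comb_color_range by auto
    fix u v d assume "u \<noteq> v \<and> (comb_color \<circ> \<phi>) u = (comb_color \<circ> \<phi>) v \<and> (u, v) \<in> parcs ?X ^^ d"
    then show "(comb_color \<circ> \<phi>) u < d"
      using comb_color_packing[of "\<phi> u" "\<phi> v"] inj[of u v] lip[of u v d] by fastforce
  qed
  then show ?thesis by blast
qed


section \<open>Five colors do not suffice\<close>

text \<open>
  A list holds the colors of consecutive spine vertices of the caterpillar. An inner spine vertex of
  color 1 has two leaves and four neighbors in all, which need four distinct colors from 2 to 5, so
  the colors of its leaves are determined by its spine neighbors. The leaf colors of the spine vertex
  at index \<open>i + 1\<close> are entry \<open>i\<close> of \<open>leaf_colors\<close>.
\<close>

fun leaf_colors :: "nat list \<Rightarrow> nat list list" where
  "leaf_colors (a # b # d # xs) =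
    (if b = 1 then filter (\<lambda>c. c \<noteq> a \<and> c \<noteq> d) [2, 3, 4, 5] else []) # leaf_colors (b # d # xs)"
| "leaf_colors xs = []"

text \<open>
  Prepending \<open>c\<close> can only create conflicts that involve \<open>c\<close> itself or a leaf of the vertex at
  index 1 of \<open>c # xs\<close>, whose second spine neighbor has just become known.
\<close>

definition admissible :: "nat \<Rightarrow> nat list \<Rightarrow> bool" where
  "admissible c xs \<longleftrightarrow>
    (let ls = leaf_colors (c # xs) in
      c \<notin> set (take c xs) \<and> c \<notin> set (concat (take (c - 1) ls)) \<and>
      (ls \<noteq> [] \<longrightarrow> list_all (\<lambda>d. d \<notin> set (take (d - 1) (tl xs)) \<and>
                               d \<notin> set (concat (take (d - 2) (tl ls)))) (hd ls)))"

text \<open>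
  The nested conditionals keep \<open>code_simp\<close> from evaluating branches that are already pruned.
\<close>

fun no_completion :: "nat \<Rightarrow> nat list \<Rightarrow> nat list \<Rightarrow> bool" where
  "no_completion n [] xs = True"
| "no_completion 0 (c # cs) xs = False"
| "no_completion (Suc n) (c # cs) xs =
    (if admissible c xs then if no_completion n [1, 2, 3, 4, 5] (c # xs) then no_completion (Suc n) cs xs else False
     else no_completion (Suc n) cs xs)"

lemma no_completion_12: "no_completion 12 [1, 2, 3, 4, 5] []"
  by code_simp

section \<open>Soundness of the search\<close>

lemma no_completion_Suc_member:
  assumes "no_completion (Suc n) cs xs" and "c \<in> set cs" and "admissible c xs"
  shows "no_completion n [1, 2, 3, 4, 5] (c # xs)"
  using assms by (induction cs) (auto split: if_splits)

text \<open>Applied only at inner indices, where \<open>i - 1\<close> is not truncated.\<close>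

definition spine_leaf :: "(nat \<Rightarrow> nat) \<Rightarrow> nat \<Rightarrow> nat \<Rightarrow> bool" where
  "spine_leaf x i c \<longleftrightarrow> x i = 1 \<and> c \<in> {2, 3, 4, 5} \<and> c \<noteq> x (i - 1) \<and> c \<noteq> x (i + 1)"

definition leaf_list :: "(nat \<Rightarrow> nat) \<Rightarrow> nat \<Rightarrow> nat list" where
  "leaf_list x i = filter (spine_leaf x i) [2, 3, 4, 5]"

lemma set_leaf_list: "c \<in> set (leaf_list x i) \<longleftrightarrow> spine_leaf x i c"
  by (auto simp: leaf_list_def spine_leaf_def)

lemma leaf_colors_map_upt:
  "leaf_colors (map x [k..<n]) =
    map (leaf_list x) [Suc k..<n - 1]"
proof (induction "n - k" arbitrary: k)
  case 0
  then show ?case by simp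
next
  case (Suc d)
  show ?case
  proof (cases "k + 2 < n")
    case True
    then have upt: "[k..<n] = k # Suc k # Suc (Suc k) # [Suc (Suc (Suc k))..<n]"
      "[Suc k..<n] = Suc k # Suc (Suc k) # [Suc (Suc (Suc k))..<n]"
      "[Suc k..<n - 1] = Suc k # [Suc (Suc k)..<n - 1]"
      by (simp_all add: upt_conv_Cons)
    have "leaf_colors (map x [k..<n]) =
      leaf_list x (Suc k) # leaf_colors (map x [Suc k..<n])"
    proof -
      have "filter (\<lambda>c. c \<noteq> x k \<and> c \<noteq> x (Suc (Suc k))) [2, 3, 4, 5] = leaf_list x (Suc k)"
        if "x (Suc k) = 1"
        unfolding leaf_list_def using that by (intro filter_cong) (auto simp: spine_leaf_def)
      moreover have "[] = leaf_list x (Suc k)" if "x (Suc k) \<noteq> 1"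
        using that by (simp add: leaf_list_def spine_leaf_def)
      ultimately show ?thesis
        unfolding upt list.map leaf_colors.simps(1) by simp
    qed
    also have "leaf_colors (map x [Suc k..<n]) =
        map (leaf_list x) [Suc (Suc k)..<n - 1]"
      using Suc(2) by (intro Suc(1)) simp
    finally show ?thesis unfolding upt(3) by simp
  next
    case False
    with Suc(2) have "n = Suc k \<or> n = Suc (Suc k)" by auto
    then show ?thesis by (auto simp: upt_conv_Cons)
  qed
qed

lemma mem_take_map_upt:
  "c \<in> set (take j (map x [k..<n])) \<longleftrightarrow> (\<exists>i\<in>{k..<n}. i < k + j \<and> x i = c)"
proof -
  have "take j [k..<n] = [k..<min n (k + j)]"
    by (cases "k + j \<le> n") (simp_all add: take_upt min_def)
  then show ?thesis by (auto simp: take_map)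
qed

text \<open>The last three hypotheses are the packing conditions for spine distance plus 1 for each
  leaf involved. A coloring meeting them would survive every pruning of the search.\<close>

lemma no_spine_coloring:
  fixes x :: "nat \<Rightarrow> nat"
  assumes range: "\<And>i. i < 12 \<Longrightarrow> x i \<in> {1..5}"
    and spine: "\<And>i j. i < j \<Longrightarrow> j < 12 \<Longrightarrow> x i = x j \<Longrightarrow> x i < j - i"
    and leaf_spine: "\<And>i j c. 0 < i \<Longrightarrow> i < 11 \<Longrightarrow> j < 12 \<Longrightarrow> i \<noteq> j \<Longrightarrow>
      spine_leaf x i c \<Longrightarrow> x j = c \<Longrightarrow> c < max i j - min i j + 1"
    and leaf_leaf: "\<And>i j c. 0 < i \<Longrightarrow> i < j \<Longrightarrow> j < 11 \<Longrightarrow>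
      spine_leaf x i c \<Longrightarrow> spine_leaf x j c \<Longrightarrow> c < j - i + 2"
  shows False
proof -
  have adm: "admissible (x k) (map x [Suc k..<12])" if "k < 12" for k
  proof -
    define ls where "ls = leaf_colors (x k # map x [Suc k..<12])"
    have "ls = leaf_colors (map x [k..<12])"
      unfolding ls_def using that by (simp add: upt_conv_Cons)
    also have "\<dots> = map (leaf_list x) [Suc k..<11]"
      by (simp add: leaf_colors_map_upt)
    finally have ls: "ls = map (leaf_list x) [Suc k..<11]" .
    \<comment> \<open>Vertex \<open>k\<close> has distance j + 1 to entry j of the spine list and j
      + 2 to the leaves in entry j of \<open>ls\<close>, whence the cut-offs \<open>x k\<close> and
      \<open>x k - 1\<close>. For a leaf of \<open>Suc k\<close> and the tails, the distances are j
      + 2 and j + 3, whence \<open>d - 1\<close> and \<open>d - 2\<close>.\<close>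
    have 1: "x k \<notin> set (take (x k) (map x [Suc k..<12]))"
    proof
      assume "x k \<in> set (take (x k) (map x [Suc k..<12]))"
      then obtain i where "i \<in> {Suc k..<12}" "i < Suc k + x k" "x i = x k"
        unfolding mem_take_map_upt by auto
      then show False using spine[of k i] by auto
    qed
    have 2: "x k \<notin> set (concat (take (x k - 1) ls))"
    proof
      assume "x k \<in> set (concat (take (x k - 1) ls))"
      then obtain l where "l \<in> set (take (x k - 1) ls)" "x k \<in> set l" by auto
      then obtain i where "i \<in> {Suc k..<11}" "i < Suc k + (x k - 1)" "spine_leaf x i (x k)"
        unfolding ls mem_take_map_upt by (auto simp: set_leaf_list)
      then show False using leaf_spine[of i k "x k"] by auto
    qed
    have 3: "d \<notin> set (take (d - 1) (tl (map x [Suc k..<12]))) \<and> d \<notin> set (concat (take (d - 2) (tl ls)))"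
      if "ls \<noteq> []" "d \<in> set (hd ls)" for d
    proof -
      have k: "Suc k < 11" using that(1) unfolding ls by simp
      have d: "spine_leaf x (Suc k) d"
        using that(2) k unfolding ls by (simp add: upt_conv_Cons set_leaf_list)
      have tls: "tl (map x [Suc k..<12]) = map x [Suc (Suc k)..<12]"
        "tl ls = map (leaf_list x) [Suc (Suc k)..<11]"
        using k unfolding ls by (simp_all add: upt_conv_Cons)
      show ?thesis
      proof (intro conjI notI)
        assume "d \<in> set (take (d - 1) (tl (map x [Suc k..<12])))"
        then obtain i where "i \<in> {Suc (Suc k)..<12}" "i < Suc (Suc k) + (d - 1)" "x i = d"
          unfolding tls mem_take_map_upt by auto
        then show False using leaf_spine[of "Suc k" i d] d k by auto
      next
        assume "d \<in> set (concat (take (d - 2) (tl ls)))"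
        then obtain l where "l \<in> set (take (d - 2) (tl ls))" "d \<in> set l" by auto
        then obtain i where "i \<in> {Suc (Suc k)..<11}" "i < Suc (Suc k) + (d - 2)" "spine_leaf x i d"
          unfolding tls mem_take_map_upt by (auto simp: set_leaf_list)
        then show False using leaf_leaf[of "Suc k" i d] d k by auto
      qed
    qed
    show ?thesis
      unfolding admissible_def Let_def ls_def[symmetric] list_all_iff using 1 2 3 by blast
  qed
  \<comment> \<open>Induction from \<open>k = 0\<close>, where all colors are placed, to
    \<open>k = 12\<close>, where the list is empty and the computed search is contradicted.\<close>
  have "\<not> no_completion k [1, 2, 3, 4, 5] (map x [k..<12])" if "k \<le> 12" for k
    using that
  proof (induction k)
    case 0
    then show ?case by simp
  next
    case (Suc k)
    show ?case
    proof
      assume "no_completion (Suc k) [1, 2, 3, 4, 5] (map x [Suc k..<12])"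
      moreover have "x k \<in> set [1, 2, 3, 4, 5]"
        using range[of k] Suc.prems by auto
      ultimately have "no_completion k [1, 2, 3, 4, 5] (x k # map x [Suc k..<12])"
        using adm[of k] Suc.prems by (intro no_completion_Suc_member[where cs = "[1, 2, 3, 4, 5]"]) auto
      then show False using Suc by (simp add: upt_conv_Cons)
    qed
  qed
  from this[of 12] no_completion_12 show False by simp
qed

section \<open>The caterpillar inside the product\<close>

lemma five_colors_insufficient:
  assumes "n \<ge> 3" "m \<ge> 12" "k \<le> 5"
  shows "\<not> packing_coloring (sierpinski_product (path_graph m) (\<lambda>g\<in>{1..m}. 2) (path_graph n)) k c"
proof
  define X where "X = sierpinski_product (path_graph m) (\<lambda>g\<in>{1..m}. 2) (path_graph n)"
  assume "packing_coloring (sierpinski_product (path_graph m) (\<lambda>g\<in>{1..m}. 2) (path_graph n)) k c"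
  moreover have "wf_digraph (with_proj X)"
    unfolding X_def using assms by (intro wf_sierpinski_product_path_graph) auto
  ultimately have c: "c \<in> pverts X \<rightarrow> {1..k}"
    and pack: "\<And>u v d. u \<in> pverts X \<Longrightarrow> v \<in> pverts X \<Longrightarrow> u \<noteq> v \<Longrightarrow> c u = c v \<Longrightarrow>
      (u, v) \<in> parcs X ^^ d \<Longrightarrow> c u < d"
    unfolding X_def[symmetric] by (auto simp: packing_coloring_iff)
  have verts: "pverts X = {1..m} \<times> {1..n}"
    by (simp add: X_def sierpinski_product_def path_graph_def)
  have range: "c (g, h) \<in> {1..5}" if "g \<in> {1..m}" "h \<in> {1..n}" for g h
  proof -
    have "c (g, h) \<in> {1..k}" using c that unfolding verts by blast
    then show ?thesis using assms(3) by auto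
  qed
  have arc_spine: "((g, 2), (Suc g, 2)) \<in> parcs X" "((Suc g, 2), (g, 2)) \<in> parcs X"
    if "1 \<le> g" "Suc g \<le> m" for g
    using that by (auto simp: X_def sierpinski_product_def path_graph_def)
  have arc_leaf: "((g, 2), (g, h)) \<in> parcs X" "((g, h), (g, 2)) \<in> parcs X"
    if "1 \<le> g" "g \<le> m" "h \<in> {1, 3}" for g h
    using that assms(1) by (auto simp: X_def sierpinski_product_def path_graph_def)
  have up: "((g, 2), (g + d, 2)) \<in> parcs X ^^ d" if "1 \<le> g" "g + d \<le> m" for g d
    using that
  proof (induction d)
    case (Suc d)
    then show ?case
      using arc_spine(1)[of "g + d"] by (intro relpow_Suc_I[of _ "(g + d, 2)"]) auto
  qed simp
  have down: "((g + d, 2), (g, 2)) \<in> parcs X ^^ d" if "1 \<le> g" "g + d \<le> m" for g d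
    using that
  proof (induction d)
    case (Suc d)
    then show ?case
      using arc_spine(2)[of "g + d"] by (intro relpow_Suc_I2[of _ "(g + d, 2)"]) auto
  qed simp
  have spine_walk: "((g, 2), (g', 2)) \<in> parcs X ^^ (max g g' - min g g')"
    if "g \<in> {1..m}" "g' \<in> {1..m}" for g g'
    using up[of g "g' - g"] down[of g' "g - g'"] that by (cases "g \<le> g'") (auto simp: max_def min_def)
  \<comment> \<open>Copies are numbered from 1, spine indices from 0.\<close>
  define x where "x i = c (Suc i, 2)" for i
  \<comment> \<open>The four neighbors of a vertex of color 1 avoid 1 and are joined pairwise by
    walks of length 2, so they cannot share a color and use all of 2 to 5. Those missing on the
    spine neighbors sit on the leaves.\<close>
  have leaf: "\<exists>h\<in>{1, 3}. c (Suc i, h) = a" if "0 < i" "i < 11" "spine_leaf x i a" for i a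
  proof -
    let ?N = "{(i, 2), (Suc (Suc i), 2), (Suc i, 1), (Suc i, 3)} :: (nat \<times> nat) set"
    have arcs: "((i, 2), (Suc i, 2)) \<in> parcs X" "((Suc i, 2), (i, 2)) \<in> parcs X"
      "((Suc i, 2), (Suc (Suc i), 2)) \<in> parcs X" "((Suc (Suc i), 2), (Suc i, 2)) \<in> parcs X"
      "((Suc i, 2), (Suc i, 1)) \<in> parcs X" "((Suc i, 1), (Suc i, 2)) \<in> parcs X"
      "((Suc i, 2), (Suc i, 3)) \<in> parcs X" "((Suc i, 3), (Suc i, 2)) \<in> parcs X"
      using that(1,2) assms(2) by (intro arc_spine arc_leaf; simp)+
    have N: "v \<in> pverts X \<and> (v, (Suc i, 2)) \<in> parcs X \<and> ((Suc i, 2), v) \<in> parcs X \<and> v \<noteq> (Suc i, 2)"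
      if "v \<in> ?N" for v
    proof -
      have "v \<in> pverts X" "v \<noteq> (Suc i, 2)"
        using that \<open>0 < i\<close> \<open>i < 11\<close> assms unfolding verts by auto
      moreover have "(v, (Suc i, 2)) \<in> parcs X" "((Suc i, 2), v) \<in> parcs X"
        using that by (elim insertE emptyE; simp only: arcs)+
      ultimately show ?thesis by blast
    qed
    have center: "(Suc i, 2) \<in> pverts X"
      using \<open>i < 11\<close> assms unfolding verts by auto
    have one: "c (Suc i, 2) = 1"
      using \<open>spine_leaf x i a\<close> by (simp add: spine_leaf_def x_def)
    have cN: "c v \<in> {2..5}" if "v \<in> ?N" for v
    proof -
      have "c v \<noteq> 1"
        using pack[of v "(Suc i, 2)" 1] N[OF that] one center by auto
      moreover have "c v \<in> {1..5}"
        using N[OF that] range by (cases v) (auto simp: verts)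
      ultimately show ?thesis by auto
    qed
    have "inj_on c ?N"
    proof (rule inj_onI, rule ccontr)
      fix u v assume uv: "u \<in> ?N" "v \<in> ?N" "c u = c v" "u \<noteq> v"
      have "(u, v) \<in> parcs X ^^ 2"
        using N[OF uv(1)] N[OF uv(2)] by (auto simp: numeral_2_eq_2)
      with pack[of u v 2] N uv have "c u < 2" by blast
      with cN[OF uv(1)] show False by simp
    qed
    then have "card (c ` ?N) = card ?N" by (rule card_image)
    also have "\<dots> = 4" by simp
    finally have "c ` ?N = {2..5}"
      using cN by (intro card_subset_eq) auto
    moreover have "a \<in> {2..5}" "a \<noteq> c (i, 2)" "a \<noteq> c (Suc (Suc i), 2)"
      using \<open>spine_leaf x i a\<close> \<open>0 < i\<close> by (auto simp: spine_leaf_def x_def)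
    ultimately have "a \<in> c ` ?N" by blast
    with \<open>a \<noteq> c (i, 2)\<close> \<open>a \<noteq> c (Suc (Suc i), 2)\<close> show ?thesis by auto
  qed
  show False
  proof (rule no_spine_coloring[of x])
    show "x i \<in> {1..5}" if "i < 12" for i
      using that assms range by (auto simp: x_def)
    show "x i < j - i" if "i < j" "j < 12" "x i = x j" for i j
      using pack[of "(Suc i, 2)" "(Suc j, 2)" "j - i"] spine_walk[of "Suc i" "Suc j"] that assms
      by (auto simp: x_def verts max_def min_def)
    show "a < max i j - min i j + 1"
      if ij: "0 < i" "i < 11" "j < 12" "i \<noteq> j" and a: "spine_leaf x i a" "x j = a" for i j a
    proof -
      obtain h where h: "h \<in> {1, 3}" "c (Suc i, h) = a"
        using leaf[OF ij(1,2) a(1)] by blast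
      have "((Suc j, 2), (Suc i, h)) \<in> parcs X ^^ Suc (max i j - min i j)"
        using spine_walk[of "Suc j" "Suc i"] arc_leaf(1)[of "Suc i" h] ij h assms
        by (auto simp: max_def min_def)
      from pack[OF _ _ _ _ this] ij h a(2) assms show ?thesis
        by (auto simp: x_def verts)
    qed
    show "a < j - i + 2"
      if ij: "0 < i" "i < j" "j < 11" and a: "spine_leaf x i a" "spine_leaf x j a" for i j a
    proof -
      obtain h where h: "h \<in> {1, 3}" "c (Suc i, h) = a"
        using leaf[OF _ _ a(1)] ij by auto
      obtain h' where h': "h' \<in> {1, 3}" "c (Suc j, h') = a"
        using leaf[OF _ _ a(2)] ij by auto
      have "((Suc i, 2), (Suc j, 2)) \<in> parcs X ^^ (j - i)"
        using spine_walk[of "Suc i" "Suc j"] ij assms by (auto simp: max_def min_def)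
      moreover have "((Suc i, h), (Suc i, 2)) \<in> parcs X" "((Suc j, 2), (Suc j, h')) \<in> parcs X"
        using ij h h' assms by (intro arc_leaf; simp)+
      ultimately have "((Suc i, h), (Suc j, h')) \<in> parcs X ^^ Suc (Suc (j - i))"
        by (intro relpow_Suc_I[of _ "(Suc j, 2)"] relpow_Suc_I2[of _ "(Suc i, 2)"])
      from pack[OF _ _ _ _ this] ij h h' assms show ?thesis
        by (auto simp: verts)
    qed
  qed
qed

section \<open>Both bounds combined\<close>

theorem theorem4p4:
  fixes m n :: nat
  assumes "n \<ge> 3" and "m \<ge> 12"
  shows "upper_sierpinski_packing_chromatic_number (path_graph m) (path_graph n) \<in> {6, 7}"
proof -
  let ?\<chi> = "\<lambda>f. packing_chromatic_number (sierpinski_product (path_graph m) f (path_graph n))"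
  let ?F = "pverts (path_graph m) \<rightarrow>\<^sub>E pverts (path_graph n)"
  let ?max = "upper_sierpinski_packing_chromatic_number (path_graph m) (path_graph n)"
  have verts: "pverts (path_graph m) = {1..m}" "pverts (path_graph n) = {1..n}"
    by (simp_all add: path_graph_def)
  have fin: "finite ?F" by (simp add: verts finite_PiE)
  obtain f where f: "f \<in> ?F" "?\<chi> f = ?max"
    using upper_sierpinski_packing_chromatic_number_attained[of "path_graph m" "path_graph n"] assms
    by (auto simp: verts)
  then obtain c where "packing_coloring (sierpinski_product (path_graph m) f (path_graph n)) 7 c"
    using packing_coloring_sierpinski_product_path_graph[of f m n] by (auto simp: verts PiE_def)
  then have "?\<chi> f \<le> 7"
    unfolding packing_chromatic_number_def by (intro Least_le) blast
  moreover have "6 \<le> ?max"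
  proof -
    \<comment> \<open>Restricted to \<open>{1..m}\<close>, as the maximum runs over extensional
      functions.\<close>
    let ?g = "\<lambda>g\<in>{1..m}. 2 :: nat"
    have "?g \<in> ?F" using assms by (auto simp: verts)
    then have "?\<chi> ?g \<le> ?max"
      unfolding upper_sierpinski_packing_chromatic_number_def using fin by (intro Max_ge) auto
    moreover have "\<not> ?\<chi> ?g \<le> 5"
    proof
      assume "?\<chi> ?g \<le> 5"
      moreover have "finite (pverts (sierpinski_product (path_graph m) ?g (path_graph n)))"
        by (simp add: sierpinski_product_def path_graph_def)
      then obtain c where
        "packing_coloring (sierpinski_product (path_graph m) ?g (path_graph n)) (?\<chi> ?g) c"
        using packing_chromatic_number_attained by blast
      ultimately show False using five_colors_insufficient[OF assms] by blast
    qed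
    ultimately show ?thesis by simp
  qed
  ultimately show ?thesis using f(2) by auto
qed

end
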